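(* Let $\mathcal{T}$ be a (nondegenerate) triangle and let $r$ be a positive integer. Then $\mathbb{E}^{4}\overset{r}{\rightarrow}(\mathcal{T};\mathcal{T})_{\mathrm{GR}}$; that is, every coloring $\chi:\mathbb{E}^4\to\{1,\dots,r\}$ contains a monochromatic congruent copy of $\mathcal{T}$ or a rainbow congruent copy of $\mathcal{T}$.
   Context: $\mathbb{E}^n$ denotes $n$-dimensional Euclidean space. A triangle is identified with its set of three non-collinear vertices. A congruent copy of a finite point set is its image under a distance-preserving map. A copy is monochromatic if all its points have the same color, and rainbow if its points have pairwise distinct colors. For configurations $\mathcal{K}_1,\mathcal{K}_2$, the notation $\mathbb{E}^n \overset{r}{\rightarrow} (\mathcal{K}_1;\mathcal{K}_2)_{\mathrm{GR}}$ means that every coloring $\chi:\mathbb{E}^n\to[r]=\{1,\dots,r\}$ yields a monochromatic congruent copy of $\mathcal{K}_1$ or a rainbow congruent copy of $\mathcal{K}_2$. *)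

theory Defs
  imports "HOL-Analysis.Analysis"
begin

definition is_triangle :: "'b::euclidean_space set \<Rightarrow> bool" where
  "is_triangle T \<longleftrightarrow> card T = 3 \<and> \<not> collinear T"

text \<open>The distance-preserving map is only required on the configuration itself, so that
  the configuration may live in a Euclidean space other than the one that is coloured.\<close>

definition congruent_copy :: "'b::euclidean_space set \<Rightarrow> 'a::euclidean_space set \<Rightarrow> bool" where
  "congruent_copy K C \<longleftrightarrow>
     (\<exists>f. (\<forall>x\<in>K. \<forall>y\<in>K. dist (f x) (f y) = dist x y) \<and> C = f ` K)"

definition monochromatic :: "('a \<Rightarrow> nat) \<Rightarrow> 'a set \<Rightarrow> bool" where
  "monochromatic col C \<longleftrightarrow> (\<forall>x\<in>C. \<forall>y\<in>C. col x = col y)"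

definition rainbow :: "('a \<Rightarrow> nat) \<Rightarrow> 'a set \<Rightarrow> bool" where
  "rainbow col C \<longleftrightarrow> inj_on col C"

text \<open>The Gallai--Ramsey arrow; the coloured space is given by its type.\<close>

definition gallai_ramsey ::
  "'a::euclidean_space itself \<Rightarrow> nat \<Rightarrow> 'b::euclidean_space set \<Rightarrow> 'c::euclidean_space set \<Rightarrow> bool" where
  "gallai_ramsey (_ :: 'a itself) r K\<^sub>1 K\<^sub>2 \<longleftrightarrow>
     (\<forall>col :: 'a \<Rightarrow> nat. (\<forall>x. col x \<in> {1..r}) \<longrightarrow>
        (\<exists>C. congruent_copy K\<^sub>1 C \<and> monochromatic col C) \<or>
        (\<exists>C. congruent_copy K\<^sub>2 C \<and> rainbow col C))"

end

theory Submission
  imports Defs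
begin

text \<open>Suppose a colouring of \<open>\<real>\<^sup>4\<close> gives exactly two colours to every copy of the triangle with
  sides \<open>a\<close>, \<open>b\<close>, \<open>c\<close>. The proof shows that the colouring is then constant, which is absurd since
  the triangle has a copy.

  Let \<open>x\<close> and \<open>y\<close> be close points of different colours, and let the halo \<open>S\<^sub>d\<close> of the pair
  be the set of points at distance \<open>d\<close> from both; in \<open>\<real>\<^sup>4\<close> it is a 2-sphere. Take
  \<open>q \<in> S\<^sub>a\<close> and \<open>z \<in> S\<^sub>b\<close> with \<open>dist q z = c\<close>. Both \<open>x, q, z\<close> and \<open>y, q, z\<close> are copies of
  the triangle, and this determines the colour of \<open>z\<close>: it is the colour of \<open>q\<close> after the colours of
  \<open>x\<close> and \<open>y\<close> have been exchanged. Close points of \<open>S\<^sub>a\<close> have a common neighbour in \<open>S\<^sub>b\<close>, so they have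
  the same colour, and by connectedness \<open>S\<^sub>a\<close> is monochromatic. A walk from \<open>S\<^sub>a\<close> through
  \<open>S\<^sub>b\<close> and \<open>S\<^sub>c\<close> back to \<open>S\<^sub>a\<close> exchanges the two colours three times, so the colour of
  \<open>S\<^sub>a\<close> is neither that of \<open>x\<close> nor that of \<open>y\<close>. This is lemma \<open>halo_monochromatic\<close>.

  The rest uses only this property of \<open>S\<^sub>a\<close>. Call a point an interface point if every
  neighbourhood of it contains two colours. Near an interface point \<open>m\<close> all bichromatic pairs have haloes
  of one common colour \<open>\<kappa> m\<close> (lemma \<open>haloes_agree\<close>). This colour is absent from a ball around \<open>m\<close> whose
  radius does not depend on \<open>m\<close>, the function \<open>\<kappa>\<close> is locally constant on the interface, and every point at
  distance \<open>a\<close> from \<open>m\<close> is a limit of points of colour \<open>\<kappa> m\<close> (lemma \<open>halo_colour_dense\<close>).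
  Suppose that an interface point \<open>m\<close> exists, and let \<open>n\<close> be a point nearest to \<open>m\<close> among the limits of points of
  colour \<open>\<kappa> m\<close>. Then \<open>n\<close> is an interface point with \<open>\<kappa> n \<noteq> \<kappa> m\<close> and \<open>0 < dist m n \<le> a\<close>. The
  2-sphere of points at distance \<open>a\<close> from \<open>m\<close> and \<open>n\<close> consists of limits of both colours, hence of
  interface points, and \<open>\<kappa>\<close> is constant on it. Being large enough, it contains two
  points \<open>g\<close> and \<open>g'\<close> at distance \<open>a\<close>. Now \<open>g'\<close> is a limit of points of colour \<open>\<kappa> g = \<kappa> g'\<close>, although
  this colour does not occur near \<open>g'\<close>. So the interface is empty, and the colouring is constant by
  connectedness.\<close>

section \<open>Vectors with prescribed inner products\<close>

lemma unit_vector_orthogonal_to_three: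
  fixes p q w :: "'a::euclidean_space"
  assumes "4 \<le> DIM('a)"
  obtains u where "norm u = 1" "u \<bullet> p = 0" "u \<bullet> q = 0" "u \<bullet> w = 0"
proof -
  have "dim {p, q, w} \<le> card {p, q, w}"
    by (rule dim_le_card) (auto intro: span_base)
  also have "card {p, q, w} \<le> 3"
    by (simp add: card_insert_if)
  finally have "dim {p, q, w} < DIM('a)"
    using assms by simp
  then obtain v where v: "v \<noteq> 0" "\<And>y. y \<in> span {p, q, w} \<Longrightarrow> orthogonal v y"
    using orthogonal_to_subspace_exists by blast
  have "orthogonal v p" "orthogonal v q" "orthogonal v w"
    by (auto intro!: v(2) span_base)
  then show thesis
    using v(1) by (intro that[of "v /\<^sub>R norm v"]) (auto simp: orthogonal_def)
qed

text \<open>The component of \<open>v\<close> along \<open>w\<close> is forced; the bound says that it is not longer than \<open>d\<close>, and the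
  missing length is supplied by a direction orthogonal to \<open>n1\<close>, \<open>n2\<close> and \<open>w\<close>. All
  points with prescribed distances below are found in this way. The fourth dimension is what makes room for two
  orthogonality conditions.\<close>
lemma vector_with_prescribed_inner:
  fixes n1 n2 w :: "'a::euclidean_space"
  assumes "4 \<le> DIM('a)" and "w \<bullet> n1 = 0" "w \<bullet> n2 = 0"
    and "0 \<le> d" and K: "K\<^sup>2 \<le> d\<^sup>2 * (norm w)\<^sup>2"
  obtains v where "v \<bullet> n1 = 0" "v \<bullet> n2 = 0" "v \<bullet> w = K" "norm v = d"
proof -
  obtain u where u: "norm u = 1" "u \<bullet> n1 = 0" "u \<bullet> n2 = 0" "u \<bullet> w = 0"
    using unit_vector_orthogonal_to_three[OF assms(1)] by metis
  define s where "s = K / (norm w)\<^sup>2"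
  have s1: "s * (w \<bullet> w) = K"
    using K by (cases "w = 0") (auto simp: s_def power2_norm_eq_inner)
  have s2: "s\<^sup>2 * (w \<bullet> w) \<le> d\<^sup>2"
  proof (cases "w = 0")
    case False
    then have "s\<^sup>2 * (w \<bullet> w) = K\<^sup>2 / (norm w)\<^sup>2"
      by (simp add: s_def power2_norm_eq_inner power_divide power2_eq_square[of "w \<bullet> w"])
    also have "\<dots> \<le> d\<^sup>2"
      using False K by (simp add: divide_le_eq)
    finally show ?thesis .
  qed simp
  define t where "t = sqrt (d\<^sup>2 - s\<^sup>2 * (w \<bullet> w))"
  have t: "t\<^sup>2 = d\<^sup>2 - s\<^sup>2 * (w \<bullet> w)"
    using s2 by (simp add: t_def)
  define v where "v = s *\<^sub>R w + t *\<^sub>R u"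
  have uu: "u \<bullet> u = 1"
    using u(1) by (simp add: norm_eq_1)
  have "v \<bullet> v = s\<^sup>2 * (w \<bullet> w) + t\<^sup>2"
    using u(4) uu by (simp add: v_def inner_add inner_commute[of w u] power2_eq_square algebra_simps)
  then have "(norm v)\<^sup>2 = d\<^sup>2"
    using t by (simp add: power2_norm_eq_inner)
  then have "norm v = d"
    using assms(4) by (simp add: power2_eq_iff_nonneg)
  moreover have "v \<bullet> n1 = 0" "v \<bullet> n2 = 0" "v \<bullet> w = K"
    using u assms(2,3) s1 by (simp_all add: v_def inner_add)
  ultimately show thesis
    using that by blast
qed

section \<open>Intersections of two spheres of equal radius\<close>

definition equidistant :: "real \<Rightarrow> 'a::metric_space \<Rightarrow> 'a \<Rightarrow> 'a set" where
  "equidistant d x y = {q. dist q x = d \<and> dist q y = d}"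

lemma equidistant_commute: "equidistant d x y = equidistant d y x"
  by (auto simp: equidistant_def)

lemma dist_sq: "(dist x y)\<^sup>2 = (x - y) \<bullet> (x - y)" for x y :: "'a::real_inner"
  by (simp add: dist_norm power2_norm_eq_inner)

lemma dist_eq_iff: "0 \<le> d \<Longrightarrow> dist x y = d \<longleftrightarrow> (x - y) \<bullet> (x - y) = d\<^sup>2" for x y :: "'a::real_inner"
  by (metis dist_sq power2_eq_iff_nonneg zero_le_dist)

lemma mem_equidistant_iff:
  fixes x y :: "'a::euclidean_space"
  assumes "0 \<le> d"
  shows "midpoint x y + v \<in> equidistant d x y \<longleftrightarrow>
         v \<bullet> (x - y) = 0 \<and> (norm v)\<^sup>2 = d\<^sup>2 - (dist x y)\<^sup>2 / 4"
proof -
  define h where "h = (1/2) *\<^sub>R (x - y)"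
  have h: "midpoint x y + v - x = v - h" "midpoint x y + v - y = v + h" "x - y = 2 *\<^sub>R h"
    by (simp_all add: midpoint_def h_def algebra_simps flip: scaleR_add_left)
  show ?thesis
    unfolding equidistant_def mem_Collect_eq dist_eq_iff[OF assms] dist_sq h power2_norm_eq_inner
    by (auto simp: inner_add inner_diff inner_commute[of h v])
qed

text \<open>The set is the radial image of a punctured hyperplane, which is connected because its dimension
  is at least 2.\<close>
lemma connected_equidistant:
  fixes x y :: "'a::euclidean_space"
  assumes "4 \<le> DIM('a)" "x \<noteq> y" "0 \<le> d"
  shows "connected (equidistant d x y)"
proof (cases "(dist x y)\<^sup>2 / 4 \<le> d\<^sup>2")
  case True
  define r where "r = sqrt (d\<^sup>2 - (dist x y)\<^sup>2 / 4)"
  have r: "r\<^sup>2 = d\<^sup>2 - (dist x y)\<^sup>2 / 4" "0 \<le> r"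
    using True by (simp_all add: r_def)
  let ?H = "{v. (x - y) \<bullet> v = 0}"
  have "aff_dim ?H = int DIM('a) - 1"
    using aff_dim_hyperplane[of "x - y" 0] assms(2) by simp
  then have "connected (?H - {0})"
    using assms(1) by (intro connected_punctured_convex convex_hyperplane) auto
  moreover have "continuous_on (?H - {0}) (\<lambda>v. midpoint x y + (r / norm v) *\<^sub>R v)"
    by (auto intro!: continuous_intros)
  ultimately have "connected ((\<lambda>v. midpoint x y + (r / norm v) *\<^sub>R v) ` (?H - {0}))"
    by (rule connected_continuous_image[rotated])
  also have "(\<lambda>v. midpoint x y + (r / norm v) *\<^sub>R v) ` (?H - {0}) = equidistant d x y"
  proof (intro equalityI subsetI)
    fix q assume "q \<in> (\<lambda>v. midpoint x y + (r / norm v) *\<^sub>R v) ` (?H - {0})"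
    then obtain v where v: "(x - y) \<bullet> v = 0" "v \<noteq> 0" "q = midpoint x y + (r / norm v) *\<^sub>R v"
      by auto
    then show "q \<in> equidistant d x y"
      using r by (simp add: mem_equidistant_iff[OF assms(3)] inner_commute power_mult_distrib)
  next
    fix q assume q: "q \<in> equidistant d x y"
    define v where "v = q - midpoint x y"
    have qv: "q = midpoint x y + v"
      by (simp add: v_def)
    have v: "v \<bullet> (x - y) = 0" "(norm v)\<^sup>2 = r\<^sup>2"
      using q r unfolding qv mem_equidistant_iff[OF assms(3)] by auto
    then have nv: "norm v = r"
      using r(2) by (simp add: power2_eq_iff_nonneg)
    show "q \<in> (\<lambda>v. midpoint x y + (r / norm v) *\<^sub>R v) ` (?H - {0})"
    proof (cases "v = 0")
      case True
      obtain u where u: "norm u = 1" "u \<bullet> (x - y) = 0"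
        using unit_vector_orthogonal_to_three[OF assms(1)] by metis
      with True nv qv show ?thesis
        by (intro image_eqI[of _ _ u]) (auto simp: inner_commute)
    next
      case False
      with nv qv v(1) show ?thesis
        by (intro image_eqI[of _ _ v]) (auto simp: inner_commute)
    qed
  qed
  finally show ?thesis .
next
  case False
  have "equidistant d x y = {}"
  proof (rule equals0I)
    fix q assume q: "q \<in> equidistant d x y"
    have "midpoint x y + (q - midpoint x y) \<in> equidistant d x y"
      using q by simp
    then show False
      using False zero_le_power2[of "norm (q - midpoint x y)"]
      unfolding mem_equidistant_iff[OF assms(3)] by linarith
  qed
  then show ?thesis
    by simp
qed

section \<open>Common neighbours\<close>

text \<open>Heron's formula: the expression is 16 times the squared area of the triangle.\<close>
lemma heron_pos:
  fixes a b c :: real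
  assumes "0 < a" "0 < b" "0 < c" "a < b + c" "b < a + c" "c < a + b"
  shows "0 < 4 * a\<^sup>2 * b\<^sup>2 - (a\<^sup>2 + b\<^sup>2 - c\<^sup>2)\<^sup>2"
proof -
  have "4 * a\<^sup>2 * b\<^sup>2 - (a\<^sup>2 + b\<^sup>2 - c\<^sup>2)\<^sup>2 = (a + b + c) * (a + b - c) * (b + c - a) * (a + c - b)"
    by algebra
  then show ?thesis
    using assms by simp
qed

text \<open>For \<open>x = y\<close> and \<open>q = q'\<close> the claim is that a segment of length \<open>a\<close> can be completed to a
  triangle with sides \<open>a\<close>, \<open>b\<close>, \<open>c\<close>. Nondegeneracy leaves room to pull the points \<open>x\<close>, \<open>y\<close> and \<open>q\<close>, \<open>q'\<close>
  slightly apart: the solvability condition of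
  \<open>vector_with_prescribed_inner\<close> changes continuously with their distances, and it is strict at distance 0.\<close>
lemma common_neighbour:
  fixes a b c :: real
  assumes dim: "4 \<le> DIM('a::euclidean_space)"
    and "0 < a" "0 < b" "0 < c" "a < b + c" "b < a + c" "c < a + b"
  obtains e where "0 < e"
    "\<And>x y q q' :: 'a. dist x y \<le> e \<Longrightarrow> dist q q' \<le> e \<Longrightarrow> q \<in> equidistant a x y \<Longrightarrow>
       q' \<in> equidistant a x y \<Longrightarrow> \<exists>z \<in> equidistant b x y. dist z q = c \<and> dist z q' = c"
proof -
  define D where "D = 4 * a\<^sup>2 * b\<^sup>2 - (a\<^sup>2 + b\<^sup>2 - c\<^sup>2)\<^sup>2"
  have "0 < D"
    using heron_pos assms unfolding D_def by blast
  define e where "e = min b (sqrt (D / (b\<^sup>2 + c\<^sup>2)))"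
  have bc: "0 < b\<^sup>2 + c\<^sup>2"
    using assms by (simp add: add_pos_pos)
  have e: "0 < e" "e \<le> b"
    using \<open>0 < D\<close> assms bc by (auto simp: e_def)
  have "e\<^sup>2 \<le> (sqrt (D / (b\<^sup>2 + c\<^sup>2)))\<^sup>2"
    using e by (intro power_mono) (auto simp: e_def)
  also have "\<dots> = D / (b\<^sup>2 + c\<^sup>2)"
    using \<open>0 < D\<close> bc by simp
  finally have eD: "e\<^sup>2 * (b\<^sup>2 + c\<^sup>2) \<le> D"
    using bc by (simp add: field_simps)
  show thesis
  proof (rule that[OF e(1)])
    fix x y q q' :: 'a
    assume xy: "dist x y \<le> e" and qq': "dist q q' \<le> e"
      and q: "q \<in> equidistant a x y" and q': "q' \<in> equidistant a x y"
    define m Q Q' E F where "m = midpoint x y" and "Q = q - m" and "Q' = q' - m"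
      and "E = (dist x y)\<^sup>2 / 4" and "F = (dist q q')\<^sup>2 / 4"
    have Q: "Q \<bullet> (x - y) = 0" "Q \<bullet> Q = a\<^sup>2 - E" "Q' \<bullet> (x - y) = 0" "Q' \<bullet> Q' = a\<^sup>2 - E"
      using q q' mem_equidistant_iff[of a x y Q] mem_equidistant_iff[of a x y Q'] assms
      by (simp_all add: Q_def Q'_def m_def E_def power2_norm_eq_inner)
    have QQ': "Q - Q' = q - q'"
      by (simp add: Q_def Q'_def)
    have F: "Q \<bullet> Q' = a\<^sup>2 - E - 2 * F"
    proof -
      have "4 * F = (Q - Q') \<bullet> (Q - Q')"
        by (simp add: F_def dist_sq QQ')
      also have "\<dots> = Q \<bullet> Q + Q' \<bullet> Q' - 2 * (Q \<bullet> Q')"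
        by (simp add: inner_diff_left inner_diff_right inner_commute[of Q' Q])
      finally show ?thesis
        using Q(2,4) by linarith
    qed
    have E4: "4 * E \<le> e\<^sup>2" and F4: "4 * F \<le> e\<^sup>2" and E0: "0 \<le> E" "0 \<le> F"
      using power_mono[OF xy, of 2] power_mono[OF qq', of 2] by (simp_all add: E_def F_def)
    have Eb: "E \<le> b\<^sup>2"
      using E4 E0 power_mono[OF e(2), of 2] e(1) by simp
    \<comment> \<open>The vector \<open>z - m\<close> has to have the inner product \<open>K\<close> with both \<open>Q\<close> and \<open>Q'\<close>: equivalently,
      with their mean \<open>s\<close>, while it is orthogonal to \<open>Q - Q'\<close>.\<close>
    define s K where "s = (1/2) *\<^sub>R (Q + Q')" and "K = (a\<^sup>2 + b\<^sup>2 - c\<^sup>2 - 2 * E) / 2"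
    have s: "s \<bullet> (x - y) = 0" "s \<bullet> (Q - Q') = 0" "s \<bullet> s = a\<^sup>2 - E - F"
      using Q F by (simp_all add: s_def inner_add inner_diff inner_commute[of Q' Q])
    have "4 * E * c\<^sup>2 + 4 * F * (b\<^sup>2 - E) \<le> 4 * E * c\<^sup>2 + 4 * F * b\<^sup>2"
      using E0 by (simp add: mult_left_mono)
    also have "\<dots> \<le> e\<^sup>2 * c\<^sup>2 + e\<^sup>2 * b\<^sup>2"
      using E4 F4 by (intro add_mono mult_right_mono) auto
    also have "\<dots> \<le> D"
      using eD by (simp add: algebra_simps)
    finally have margin: "4 * E * c\<^sup>2 + 4 * F * (b\<^sup>2 - E) \<le> D" .
    have "4 * ((b\<^sup>2 - E) * (a\<^sup>2 - E - F) - K\<^sup>2) = D - (4 * E * c\<^sup>2 + 4 * F * (b\<^sup>2 - E))"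
      unfolding D_def K_def by (simp add: power2_eq_square field_simps)
    then have "K\<^sup>2 \<le> (sqrt (b\<^sup>2 - E))\<^sup>2 * (norm s)\<^sup>2"
      using margin Eb by (simp add: power2_norm_eq_inner s)
    then obtain v where v: "v \<bullet> (x - y) = 0" "v \<bullet> (Q - Q') = 0" "v \<bullet> s = K" "norm v = sqrt (b\<^sup>2 - E)"
      using vector_with_prescribed_inner[OF dim s(1,2), of "sqrt (b\<^sup>2 - E)" K] Eb by auto
    have vv: "v \<bullet> v = b\<^sup>2 - E"
      using v(4) Eb by (simp flip: power2_norm_eq_inner)
    have vQ: "v \<bullet> Q = K" "v \<bullet> Q' = K"
      using v(2,3) by (simp_all add: s_def inner_add inner_diff)
    have "m + v \<in> equidistant b x y"
      using v vv assms Eb by (simp add: m_def mem_equidistant_iff E_def power2_norm_eq_inner)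
    moreover have "dist (m + v) q = c" "dist (m + v) q' = c"
    proof -
      have "m + v - q = v - Q" "m + v - q' = v - Q'"
        by (simp_all add: Q_def Q'_def)
      then show "dist (m + v) q = c" "dist (m + v) q' = c"
        using assms vv vQ Q
        by (simp_all only: dist_eq_iff less_imp_le)
           (simp_all add: inner_diff_left inner_diff_right inner_commute[of Q v] inner_commute[of Q' v] K_def field_simps)
    qed
    ultimately show "\<exists>z \<in> equidistant b x y. dist z q = c \<and> dist z q' = c"
      by blast
  qed
qed

section \<open>Haloes of close bichromatic pairs\<close>

definition two_coloured :: "('a \<Rightarrow> 'k) \<Rightarrow> 'a \<Rightarrow> 'a \<Rightarrow> 'a \<Rightarrow> bool" where
  "two_coloured col p q z \<longleftrightarrow>
     (col p = col q \<or> col q = col z \<or> col p = col z) \<and> \<not> (col p = col q \<and> col q = col z)"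

lemma two_coloured_commute:
  "two_coloured col p q z \<longleftrightarrow> two_coloured col q p z" "two_coloured col p q z \<longleftrightarrow> two_coloured col p z q"
  unfolding two_coloured_def by metis+

text \<open>What remains of the triangle once its haloes are understood: only the length \<open>a\<close> of one side is
  left. The rest of the argument takes place in this setting.\<close>
locale monochromatic_haloes =
  fixes col :: "'a::euclidean_space \<Rightarrow> 'k" and a e :: real
  assumes dim: "4 \<le> DIM('a)" and a_pos: "0 < a" and e_pos: "0 < e"
    and halo: "\<And>x y q q'. dist x y \<le> e \<Longrightarrow> col x \<noteq> col y \<Longrightarrow> q \<in> equidistant a x y \<Longrightarrow>
       q' \<in> equidistant a x y \<Longrightarrow> col q = col q' \<and> col q \<noteq> col x \<and> col q \<noteq> col y"

text \<open>For a bichromatic pair \<open>x\<close>, \<open>y\<close>, the edges between its haloes act on colours by the transposition of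
  \<open>col x\<close> and \<open>col y\<close>. Being injective, it gives equal colours to points with a common
  neighbour; its third power is itself, so a closed walk of length three can only start at a colour that it fixes.\<close>
lemma halo_monochromatic:
  fixes col :: "'a::euclidean_space \<Rightarrow> 'k" and a b c :: real
  assumes dim: "4 \<le> DIM('a)"
    and pos: "0 < a" "0 < b" "0 < c" and tri: "a < b + c" "b < a + c" "c < a + b"
    and two: "\<And>p q z. dist p q = a \<Longrightarrow> dist p z = b \<Longrightarrow> dist q z = c \<Longrightarrow> two_coloured col p q z"
  shows "\<exists>e. monochromatic_haloes col a e"
proof -
  obtain e1 where e1: "0 < e1"
    "\<And>x y q q' :: 'a. dist x y \<le> e1 \<Longrightarrow> dist q q' \<le> e1 \<Longrightarrow> q \<in> equidistant a x y \<Longrightarrow>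
       q' \<in> equidistant a x y \<Longrightarrow> \<exists>z \<in> equidistant b x y. dist z q = c \<and> dist z q' = c"
    by (rule common_neighbour[OF dim pos tri]) auto
  obtain e2 where e2: "0 < e2"
    "\<And>x y q q' :: 'a. dist x y \<le> e2 \<Longrightarrow> dist q q' \<le> e2 \<Longrightarrow> q \<in> equidistant b x y \<Longrightarrow>
       q' \<in> equidistant b x y \<Longrightarrow> \<exists>z \<in> equidistant c x y. dist z q = a \<and> dist z q' = a"
    by (rule common_neighbour[OF dim, of b c a]) (use pos tri in \<open>auto simp: add.commute\<close>)
  obtain e3 where e3: "0 < e3"
    "\<And>x y q q' :: 'a. dist x y \<le> e3 \<Longrightarrow> dist q q' \<le> e3 \<Longrightarrow> q \<in> equidistant c x y \<Longrightarrow>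
       q' \<in> equidistant c x y \<Longrightarrow> \<exists>z \<in> equidistant a x y. dist z q = b \<and> dist z q' = b"
    by (rule common_neighbour[OF dim, of c a b]) (use pos tri in \<open>auto simp: add.commute\<close>)
  have "monochromatic_haloes col a (min e1 (min e2 e3))"
  proof
    show "4 \<le> DIM('a)" "0 < a" "0 < min e1 (min e2 e3)"
      using dim pos e1 e2 e3 by simp_all
    fix x y q q'
    assume xy: "dist x y \<le> min e1 (min e2 e3)" and bi: "col x \<noteq> col y"
      and q: "q \<in> equidistant a x y" and q': "q' \<in> equidistant a x y"
    define swap where "swap k = (if k = col x then col y else if k = col y then col x else k)" for k
    have swap_inj: "k = l" if "swap k = swap l" for k l
      using that by (auto simp: swap_def split: if_splits)
    have swap3: "k \<noteq> col x \<and> k \<noteq> col y" if "swap (swap (swap k)) = k" for k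
      using that bi by (auto simp: swap_def split: if_splits)
    have swapI: "col z = swap (col p)" if "two_coloured col x p z" "two_coloured col y p z" for p z
      using that bi
      by (cases "col p = col x"; cases "col p = col y") (auto simp: two_coloured_def swap_def)
    have ab: "col z = swap (col p)"
      if "p \<in> equidistant a x y" "z \<in> equidistant b x y" "dist z p = c" for p z
      using that by (intro swapI two) (simp_all add: equidistant_def dist_commute)
    have bc: "col z = swap (col p)"
      if "p \<in> equidistant b x y" "z \<in> equidistant c x y" "dist z p = a" for p z
    proof -
      have "two_coloured col p z x" "two_coloured col p z y"
        using that by (simp_all add: two equidistant_def dist_commute)
      then show ?thesis
        by (intro swapI) (simp_all only: two_coloured_commute)
    qed
    have ca: "col z = swap (col p)"
      if "p \<in> equidistant c x y" "z \<in> equidistant a x y" "dist z p = b" for p z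
    proof -
      have "two_coloured col z x p" "two_coloured col z y p"
        using that by (simp_all add: two equidistant_def dist_commute)
      then show ?thesis
        by (intro swapI) (simp_all only: two_coloured_commute)
    qed
    have "col constant_on equidistant a x y"
    proof (rule locally_constant_imp_constant)
      show "connected (equidistant a x y)"
        using bi pos by (intro connected_equidistant dim) auto
      fix p assume p: "p \<in> equidistant a x y"
      let ?U = "equidistant a x y \<inter> ball p e1"
      have "col p' = col p" if p': "p' \<in> ?U" for p'
      proof -
        have pp': "dist p p' \<le> e1" "p' \<in> equidistant a x y" "dist x y \<le> e1"
          using p' xy by simp_all
        obtain z where z: "z \<in> equidistant b x y" "dist z p = c" "dist z p' = c"
          using e1(2)[OF pp'(3,1) p pp'(2)] by blast
        have "swap (col p') = swap (col p)"
          by (rule trans[OF sym[OF ab[OF pp'(2) z(1,3)]] ab[OF p z(1,2)]])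
        then show ?thesis
          by (rule swap_inj)
      qed
      moreover have "openin (top_of_set (equidistant a x y)) ?U" "p \<in> ?U"
        using p e1(1) by (simp_all add: openin_open_Int)
      ultimately show "\<exists>U. openin (top_of_set (equidistant a x y)) U \<and> p \<in> U \<and> (\<forall>p'\<in>U. col p' = col p)"
        by blast
    qed
    then have const: "col p = col p'" if "p \<in> equidistant a x y" "p' \<in> equidistant a x y" for p p'
      using that unfolding constant_on_def by metis
    obtain z where z: "z \<in> equidistant b x y" "dist z q = c"
      using e1(2)[of x y q q] q xy e1(1) by auto
    obtain w where w: "w \<in> equidistant c x y" "dist w z = a"
      using e2(2)[of x y z z] z xy e2(1) by auto
    obtain p where p: "p \<in> equidistant a x y" "dist p w = b"
      using e3(2)[of x y w w] w xy e3(1) by auto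
    have "swap (swap (swap (col q))) = col p"
      unfolding ca[OF w(1) p] bc[OF z(1) w] ab[OF q z] ..
    also have "\<dots> = col q"
      using const[OF p(1) q] .
    finally have "col q \<noteq> col x \<and> col q \<noteq> col y"
      by (rule swap3)
    with const[OF q q'] show "col q = col q' \<and> col q \<noteq> col x \<and> col q \<noteq> col y"
      by blast
  qed
  then show ?thesis ..
qed

section \<open>Colourings with monochromatic haloes\<close>

lemma equidistant_nonempty:
  fixes x y :: "'a::euclidean_space"
  assumes "4 \<le> DIM('a)" "0 \<le> d" "dist x y \<le> 2 * d"
  obtains q where "q \<in> equidistant d x y"
proof -
  obtain u where u: "norm u = 1" "u \<bullet> (x - y) = 0"
    using unit_vector_orthogonal_to_three[OF assms(1)] by metis
  have "(dist x y)\<^sup>2 \<le> 4 * d\<^sup>2"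
    using power_mono[OF assms(3), of 2] by (simp add: power_mult_distrib)
  then have "midpoint x y + sqrt (d\<^sup>2 - (dist x y)\<^sup>2 / 4) *\<^sub>R u \<in> equidistant d x y"
    using u assms(2) by (simp add: mem_equidistant_iff)
  then show thesis
    by (rule that)
qed

text \<open>The circumradius of three close points is small unless they are nearly collinear. The
  foot of the perpendicular from \<open>w\<close> lies at \<open>x\<close>, so \<open>w\<close> has distance at least \<open>h\<close> from the line through
  \<open>y\<close> and \<open>z\<close>, which excludes that case. The points \<open>y\<close> and \<open>z\<close> may coincide.\<close>
lemma common_equidistant_point:
  fixes x y z w :: "'a::euclidean_space"
  assumes dim: "4 \<le> DIM('a)"
    and perp: "(w - x) \<bullet> (y - x) = 0" "(w - x) \<bullet> (z - x) = 0"
    and h: "dist w x = h" "dist y x \<le> h" "dist z x \<le> h" "2 * h \<le> d"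
  obtains q where "q \<in> equidistant d y z" "dist q w = d"
proof -
  have h0: "0 \<le> h"
    using h(1) by auto
  define m n where "m = midpoint y z" and "n = y - z"
  define t where "t = ((w - m) \<bullet> n) / (n \<bullet> n)"
  define w' where "w' = w - m - t *\<^sub>R n"
  define K where "K = ((w - y) \<bullet> (w - z)) / 2"
  have w'n: "w' \<bullet> n = 0"
    by (cases "n = 0") (simp_all add: w'_def t_def inner_diff)
  define B where "B = (x - m) - t *\<^sub>R n"
  have "x - m = - (1/2) *\<^sub>R (y - x) - (1/2) *\<^sub>R (z - x)" "n = (y - x) - (z - x)"
    by (simp_all add: m_def n_def midpoint_def algebra_simps flip: scaleR_add_left)
  then have wB: "(w - x) \<bullet> B = 0"
    using perp by (simp only: B_def inner_diff_right inner_scaleR_right) simp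
  have w'B: "w' = (w - x) + B"
    by (simp add: w'_def B_def)
  have "w' \<bullet> w' = (w - x) \<bullet> (w - x) + B \<bullet> B"
    unfolding w'B inner_add_left inner_add_right using wB inner_commute[of B "w - x"] by linarith
  then have w'h: "h\<^sup>2 \<le> w' \<bullet> w'"
    using h(1) by (simp flip: dist_sq)
  have "(w - y) \<bullet> (w - z) = (w - x) \<bullet> (w - x) + (y - x) \<bullet> (z - x)"
    using perp by (simp add: inner_diff inner_commute algebra_simps)
  then have "2 * K = h\<^sup>2 + (y - x) \<bullet> (z - x)"
    using h(1) by (simp add: K_def flip: dist_sq)
  moreover have "\<bar>(y - x) \<bullet> (z - x)\<bar> \<le> h * h"
    using Cauchy_Schwarz_ineq2[of "y - x" "z - x"] mult_mono[OF h(2,3)] h0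
    by (simp add: dist_norm)
  ultimately have K: "0 \<le> K" "K \<le> h\<^sup>2"
    by (simp_all add: power2_eq_square)
  have "dist y z \<le> 2 * h"
    using dist_triangle2[of y z x] h by linarith
  then have yz: "(dist y z)\<^sup>2 / 4 \<le> h\<^sup>2"
    using power_mono[of "dist y z" "2 * h" 2] by (simp add: power_mult_distrib)
  have d: "0 \<le> d" "4 * h\<^sup>2 \<le> d\<^sup>2"
    using h0 h(4) power_mono[of "2 * h" d 2] by (simp_all add: power_mult_distrib)
  define r where "r = sqrt (d\<^sup>2 - (dist y z)\<^sup>2 / 4)"
  have r: "r\<^sup>2 = d\<^sup>2 - (dist y z)\<^sup>2 / 4" "0 \<le> r"
  proof -
    have "0 \<le> d\<^sup>2 - (dist y z)\<^sup>2 / 4"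
      using yz d(2) zero_le_power2[of h] by linarith
    then show "r\<^sup>2 = d\<^sup>2 - (dist y z)\<^sup>2 / 4" "0 \<le> r"
      by (simp_all add: r_def)
  qed
  have "K\<^sup>2 \<le> h\<^sup>2 * h\<^sup>2"
    using K by (simp add: power2_eq_square mult_mono)
  also have "\<dots> \<le> r\<^sup>2 * (norm w')\<^sup>2"
    unfolding power2_norm_eq_inner[of w']
  proof (rule mult_mono)
    show "h\<^sup>2 \<le> r\<^sup>2"
      using r(1) yz d(2) zero_le_power2[of h] by linarith
  qed (use w'h in auto)
  finally obtain v where v: "v \<bullet> n = 0" "v \<bullet> w' = K" "norm v = r"
    using vector_with_prescribed_inner[OF dim w'n w'n, of r K] r(2) by auto
  have mem: "m + v \<in> equidistant d y z"
    using v r d unfolding m_def n_def by (simp add: mem_equidistant_iff)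
  have "v \<bullet> (w - m) = K"
    using v by (simp add: w'_def inner_diff)
  moreover have "2 * K = (w - m) \<bullet> (w - m) - (n \<bullet> n) / 4"
  proof -
    define k where "k = (1/2) *\<^sub>R n"
    have wk: "w - y = (w - m) - k" "w - z = (w - m) + k" and nk: "n = 2 *\<^sub>R k"
      by (simp_all add: k_def m_def n_def midpoint_def algebra_simps flip: scaleR_add_left)
    have "2 * K = ((w - m) - k) \<bullet> ((w - m) + k)"
      unfolding K_def wk by simp
    also have "\<dots> = (w - m) \<bullet> (w - m) - k \<bullet> k"
      by (simp only: inner_diff_left[of "w - m"] inner_add_right[of _ "w - m"] inner_commute[of k "w - m"])
    finally show ?thesis
      by (simp add: nk)
  qed
  moreover have "v \<bullet> v = d\<^sup>2 - (n \<bullet> n) / 4"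
    using v(3) r(1) by (simp add: n_def dist_sq flip: power2_norm_eq_inner)
  ultimately have "(v - (w - m)) \<bullet> (v - (w - m)) = d\<^sup>2"
    unfolding inner_diff_left[of v] inner_diff_right[of _ v] inner_commute[of "w - m" v] by linarith
  moreover have "m + v - w = v - (w - m)"
    by simp
  ultimately have "dist (m + v) w = d"
    using d(1) by (simp only: dist_eq_iff)
  then show thesis
    using mem that by blast
qed

text \<open>The vector \<open>p - z\<close> is almost orthogonal to \<open>q0 - m\<close>: its length is at least \<open>t\<close>, whereas its component
  along \<open>q0 - m\<close> has order \<open>t\<^sup>2\<close>. So projecting \<open>q0 - m\<close> to the hyperplane orthogonal to \<open>p - z\<close> and adjusting its
  length moves it only a little.\<close>
lemma equidistant_point_near:
  fixes m p z q0 u :: "'a::euclidean_space"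
  assumes q0: "dist q0 m = a" and u: "norm u = 1" "u \<bullet> (q0 - m) = 0" "u \<bullet> (z - m) = 0"
    and t: "0 < t" "t < 1" "t \<le> a" and z: "dist z m \<le> t\<^sup>2" and p: "p = m + t *\<^sub>R u"
  obtains q where "q \<in> equidistant a z p" "dist q q0 \<le> t * (1 + 2 * a + 1 / a)"
proof -
  have a: "0 < a"
    using t by linarith
  define g D f where "g = p - z" and "D = q0 - m" and "f = z - m"
  have D: "norm D = a" "u \<bullet> D = 0"
    using q0 u by (simp_all add: D_def dist_norm)
  have f: "norm f \<le> t\<^sup>2" "u \<bullet> f = 0"
    using z u by (simp_all add: f_def dist_norm)
  have gf: "g = t *\<^sub>R u - f"
    by (simp add: g_def f_def p)
  have uu: "u \<bullet> u = 1"
    using u(1) by (simp add: norm_eq_1)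
  have "g \<bullet> g = t\<^sup>2 + f \<bullet> f"
    using f(2) uu unfolding gf
    by (simp add: inner_diff_left inner_diff_right inner_commute[of f u] power2_eq_square)
  then have gg: "(norm g)\<^sup>2 = t\<^sup>2 + (norm f)\<^sup>2"
    by (simp add: power2_norm_eq_inner)
  have tt: "t\<^sup>2 \<le> t"
    using t by (simp add: power2_eq_square)
  have "(norm f)\<^sup>2 \<le> t\<^sup>2"
    using f(1) tt by (intro power_mono) auto
  then have g: "t \<le> norm g" "(norm g)\<^sup>2 \<le> 2 * t\<^sup>2"
    using gg by (auto intro: power2_le_imp_le[of t "norm g"])
  have g0: "0 < norm g"
    using g(1) t(1) by linarith
  define D' where "D' = D - ((D \<bullet> g) / (g \<bullet> g)) *\<^sub>R g"
  have D'g: "D' \<bullet> g = 0"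
    using g0 by (simp add: D'_def inner_diff)
  have "\<bar>D \<bullet> g\<bar> = \<bar>D \<bullet> f\<bar>"
    using D(2) by (simp add: gf inner_diff_right inner_commute[of D u])
  also have "\<dots> \<le> a * t\<^sup>2"
    using Cauchy_Schwarz_ineq2[of D f] D(1) f(1) a by (meson mult_left_mono order_trans less_imp_le)
  finally have Dg: "\<bar>D \<bullet> g\<bar> \<le> a * t\<^sup>2" .
  have "norm (D - D') = \<bar>D \<bullet> g\<bar> / norm g"
    using g0 by (simp add: D'_def flip: power2_norm_eq_inner) (simp add: power2_eq_square)
  also have "\<dots> \<le> a * t\<^sup>2 / t"
    using Dg g(1) t(1) a by (intro frac_le) auto
  also have "\<dots> = a * t"
    using t(1) by (simp add: power2_eq_square)
  finally have DD': "norm (D - D') \<le> a * t" .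
  moreover have "a * t < a"
    using a t by simp
  ultimately have D'0: "0 < norm D'"
    using D(1) by (cases "D' = 0") auto
  define d where "d = sqrt (a\<^sup>2 - (norm g)\<^sup>2 / 4)"
  have ta: "t\<^sup>2 \<le> a\<^sup>2"
    using t by (intro power_mono) auto
  have d: "d\<^sup>2 = a\<^sup>2 - (norm g)\<^sup>2 / 4" "0 \<le> d"
  proof -
    have "0 \<le> a\<^sup>2 - (norm g)\<^sup>2 / 4"
      using ta g(2) zero_le_power2[of a] by linarith
    then show "d\<^sup>2 = a\<^sup>2 - (norm g)\<^sup>2 / 4" "0 \<le> d"
      by (simp_all add: d_def)
  qed
  have "d \<le> a"
    using d(1) a by (intro power2_le_imp_le[of d a]) auto
  have "a * (a - d) \<le> (a + d) * (a - d)"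
    using \<open>d \<le> a\<close> d(2) by (intro mult_right_mono) auto
  also have "\<dots> = (norm g)\<^sup>2 / 4"
    using d(1) by (simp add: power2_eq_square algebra_simps)
  also have "\<dots> \<le> t"
    using g(2) tt t(1) by linarith
  finally have ad: "a - d \<le> t / a"
    using a by (simp add: pos_le_divide_eq mult.commute)
  define v where "v = (d / norm D') *\<^sub>R D'"
  have v: "v \<bullet> g = 0" "norm v = d"
    using D'g D'0 d(2) by (simp_all add: v_def)
  have "v - D' = ((d - norm D') / norm D') *\<^sub>R D'"
    using D'0 by (simp add: v_def diff_divide_distrib scaleR_diff_left)
  then have "norm (v - D') = \<bar>d - norm D'\<bar>"
    using D'0 by simp
  moreover have "\<bar>norm D - norm D'\<bar> \<le> norm (D - D')"
    by (rule norm_triangle_ineq3)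
  moreover have "norm (v - D) \<le> norm (v - D') + norm (D - D')"
    using norm_triangle_ineq4[of "v - D'" "D - D'"] by simp
  ultimately have vD: "norm (v - D) \<le> t / a + 2 * (a * t)"
    using DD' ad D(1) \<open>d \<le> a\<close> by linarith
  have mid: "midpoint z p - m = (1/2) *\<^sub>R (f + t *\<^sub>R u)"
    by (simp add: midpoint_def f_def p algebra_simps flip: scaleR_add_left)
  have "norm (midpoint z p - m) \<le> (norm f + t) / 2"
    unfolding mid using norm_triangle_ineq[of f "t *\<^sub>R u"] u(1) t(1) by simp
  then have mid': "norm (midpoint z p - m) \<le> t"
    by (rule order_trans) (use order_trans[OF f(1) tt] in simp)
  have "v \<bullet> (z - p) = 0"
    using v(1) by (simp add: g_def inner_diff_right)
  then have mem: "midpoint z p + v \<in> equidistant a z p"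
    using v(2) d(1) a by (simp add: mem_equidistant_iff g_def dist_norm norm_minus_commute)
  have "dist (midpoint z p + v) q0 = norm ((midpoint z p - m) + (v - D))"
    by (simp add: dist_norm D_def algebra_simps)
  also have "\<dots> \<le> t + (t / a + 2 * (a * t))"
    using norm_triangle_ineq[of "midpoint z p - m" "v - D"] mid' vD by linarith
  also have "\<dots> = t * (1 + 2 * a + 1 / a)"
    by (simp add: algebra_simps)
  finally show thesis
    using mem that by blast
qed

context monochromatic_haloes
begin

text \<open>A scale at which all pairs of points satisfy the distance bounds of the preceding lemmas.\<close>
definition h :: real where
  "h = min (a / 2) (e / 2)"

lemma h: "0 < h" "2 * h \<le> a" "2 * h \<le> e"
  using a_pos e_pos by (auto simp: h_def)

text \<open>Haloes of the same colour arise whenever two haloes meet. The haloes of \<open>x, y\<close> and \<open>x, z\<close> need not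
  meet, since the three points can be collinear. The detour is a point \<open>w\<close> perpendicularly above \<open>x\<close>: each of the
  triples \<open>w, x, y\<close> and \<open>w, x, z\<close> and \<open>w, y, z\<close> has a point at distance \<open>a\<close> from all its members, and \<open>w\<close> differs
  in colour from \<open>x\<close> or from both \<open>y\<close> and \<open>z\<close>.\<close>
lemma haloes_agree_of_common_point:
  assumes "dist x y \<le> h" "dist x z \<le> h" and ne: "col x \<noteq> col y" "col x \<noteq> col z"
    and q: "q \<in> equidistant a x y" "q' \<in> equidistant a x z"
  shows "col q = col q'"
proof -
  obtain u where u: "norm u = 1" "u \<bullet> (y - x) = 0" "u \<bullet> (z - x) = 0"
    using unit_vector_orthogonal_to_three[OF dim] by metis
  define w where "w = x + h *\<^sub>R u"
  have w: "(w - x) \<bullet> (y - x) = 0" "(w - x) \<bullet> (z - x) = 0" "dist w x = h"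
    using u h(1) by (simp_all add: w_def dist_norm)
  have xx: "(w - x) \<bullet> (x - x) = 0" "dist x x \<le> h"
    using h(1) by simp_all
  have yz: "dist y x \<le> h" "dist z x \<le> h"
    using assms by (simp_all add: dist_commute)
  have close: "dist x y \<le> e" "dist x z \<le> e" "dist w x \<le> e" "dist w y \<le> e" "dist w z \<le> e"
    using assms w(3) h dist_triangle[of w y x] dist_triangle[of w z x] by linarith+
  obtain q1 where q1: "q1 \<in> equidistant a y x" "dist q1 w = a"
    using common_equidistant_point[OF dim w(1) xx(1) w(3) yz(1) xx(2) h(2)] .
  obtain q2 where q2: "q2 \<in> equidistant a z x" "dist q2 w = a"
    using common_equidistant_point[OF dim w(2) xx(1) w(3) yz(2) xx(2) h(2)] .
  obtain q3 where q3: "q3 \<in> equidistant a y z" "dist q3 w = a"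
    using common_equidistant_point[OF dim w(1,2,3) yz h(2)] .
  have "col q = col q1"
    using halo[of x y q q1] close ne q q1 by (simp add: equidistant_commute)
  moreover have "col q' = col q2"
    using halo[of x z q' q2] close ne q q2 by (simp add: equidistant_commute)
  moreover have "col q1 = col q2"
  proof (cases "col w = col x")
    case False
    then show ?thesis
      using halo[of w x q1 q2] close q1 q2 by (simp add: equidistant_def)
  next
    case True
    then have "col q1 = col q3" "col q2 = col q3"
      using halo[of w y q1 q3] halo[of w z q2 q3] close ne q1 q2 q3 by (simp_all add: equidistant_def)
    then show ?thesis
      by simp
  qed
  ultimately show ?thesis
    by simp
qed

text \<open>One of \<open>x'\<close> and \<open>y'\<close> differs in colour from \<open>x\<close>, so the two pairs are linked by a third bichromatic pair that
  shares a point with each.\<close>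
lemma haloes_agree:
  assumes ball: "{x, y, x', y'} \<subseteq> ball m (h / 2)" and ne: "col x \<noteq> col y" "col x' \<noteq> col y'"
    and q: "q \<in> equidistant a x y" "q' \<in> equidistant a x' y'"
  shows "col q = col q'"
proof -
  have close: "dist s t \<le> h" if "s \<in> {x, y, x', y'}" "t \<in> {x, y, x', y'}" for s t
  proof -
    have "dist m s < h / 2" "dist m t < h / 2"
      using that ball by auto
    then show ?thesis
      using dist_triangle3[of s t m] by linarith
  qed
  have link: "col q = col q'"
    if "s \<in> {x, y, x', y'}" "t \<in> {x, y, x', y'}" and ne': "col s \<noteq> col x" "col s \<noteq> col t"
      and q'st: "q' \<in> equidistant a s t" for s t
  proof -
    have d: "dist x y \<le> h" "dist x s \<le> h" "dist s x \<le> h" "dist s t \<le> h"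
      using that by (auto intro!: close)
    obtain p where p: "p \<in> equidistant a x s"
      using equidistant_nonempty[OF dim, of a x s] d(2) h a_pos by auto
    have "col q = col p"
      using haloes_agree_of_common_point[OF d(1,2) ne(1) _ q(1) p] ne' by metis
    also have "col p = col q'"
      using haloes_agree_of_common_point[OF d(3,4) ne' _ q'st] p equidistant_commute by metis
    finally show ?thesis .
  qed
  show ?thesis
  proof (cases "col x' = col x")
    case False
    then show ?thesis
      using link[of x' y'] ne q by simp
  next
    case True
    then have "col y' \<noteq> col x" "col y' \<noteq> col x'"
      using ne by auto
    then show ?thesis
      using link[of y' x'] q(2) by (simp add: equidistant_commute)
  qed
qed

definition interface :: "'a set" where
  "interface = {m. \<forall>r>0. \<exists>x\<in>ball m r. \<exists>y\<in>ball m r. col x \<noteq> col y}"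

lemma interfaceE:
  assumes "m \<in> interface" "0 < r"
  obtains x y where "x \<in> ball m r" "y \<in> ball m r" "col x \<noteq> col y"
  using assms unfolding interface_def by blast

text \<open>This is the function \<open>\<kappa>\<close> of the introduction. At an interface point the ball contains a bichromatic pair,
  which makes the choice unique.\<close>
definition halo_colour :: "'a \<Rightarrow> 'k" where
  "halo_colour m = (SOME k. \<forall>x\<in>ball m (h / 2). \<forall>y\<in>ball m (h / 2). col x \<noteq> col y \<longrightarrow>
     (\<forall>q\<in>equidistant a x y. col q = k))"

lemma halo_nonempty:
  fixes x y :: 'a
  assumes "x \<in> ball m (h / 2)" "y \<in> ball m (h / 2)"
  obtains q where "q \<in> equidistant a x y"
proof -
  have "dist x y \<le> 2 * a"
    using assms dist_triangle3[of x y m] h a_pos by simp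
  then show thesis
    using equidistant_nonempty[OF dim, of a x y] a_pos that by auto
qed

lemma halo_colour:
  assumes "x \<in> ball m (h / 2)" "y \<in> ball m (h / 2)" "col x \<noteq> col y" "q \<in> equidistant a x y"
  shows "col q = halo_colour m"
proof -
  have "col q' = col q"
    if "x' \<in> ball m (h / 2)" "y' \<in> ball m (h / 2)" "col x' \<noteq> col y'" "q' \<in> equidistant a x' y'"
    for x' y' q'
    by (rule haloes_agree[of x' y' x y m]) (use that assms in simp_all)
  then have "\<exists>k. \<forall>x\<in>ball m (h / 2). \<forall>y\<in>ball m (h / 2). col x \<noteq> col y \<longrightarrow>
     (\<forall>q\<in>equidistant a x y. col q = k)"
    by blast
  from someI_ex[OF this] show ?thesis
    using assms unfolding halo_colour_def by blast
qed

text \<open>A point \<open>p\<close> of the ball forms a bichromatic pair with some other point of it, and the colour of their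
  halo differs from that of \<open>p\<close>.\<close>
lemma halo_colour_not_near:
  assumes m: "m \<in> interface" and p: "p \<in> ball m (h / 2)"
  shows "col p \<noteq> halo_colour m"
proof -
  obtain x y where xy: "x \<in> ball m (h / 2)" "y \<in> ball m (h / 2)" "col x \<noteq> col y"
    by (rule interfaceE[OF m half_gt_zero[OF h(1)]])
  then obtain z where z: "z \<in> ball m (h / 2)" "col p \<noteq> col z"
    by metis
  obtain q where q: "q \<in> equidistant a p z"
    using halo_nonempty p z by metis
  have "dist p z \<le> e"
    using p z h dist_triangle3[of p z m] by simp
  then show ?thesis
    using halo[of p z q q] halo_colour[OF p z q] z q by auto
qed

lemma halo_colour_eq_of_close:
  assumes m: "m \<in> interface" "m' \<in> interface" and close: "dist m m' < h / 2"
  shows "halo_colour m = halo_colour m'"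
proof -
  define r where "r = min (h / 2) (h / 2 - dist m m')"
  have "0 < r"
    using close h by (simp add: r_def)
  then obtain x y where xy: "x \<in> ball m' r" "y \<in> ball m' r" "col x \<noteq> col y"
    by (rule interfaceE[OF m(2)])
  have sub: "ball m' r \<subseteq> ball m' (h / 2)" "ball m' r \<subseteq> ball m (h / 2)"
  proof -
    show "ball m' r \<subseteq> ball m' (h / 2)"
      by (rule subset_ball) (simp add: r_def)
    show "ball m' r \<subseteq> ball m (h / 2)"
    proof
      fix z assume "z \<in> ball m' r"
      then show "z \<in> ball m (h / 2)"
        using dist_triangle[of m z m'] by (simp add: r_def)
    qed
  qed
  obtain q where q: "q \<in> equidistant a x y"
    by (rule halo_nonempty[OF subsetD[OF sub(1) xy(1)] subsetD[OF sub(1) xy(2)]])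
  show ?thesis
    using halo_colour[OF subsetD[OF sub(2) xy(1)] subsetD[OF sub(2) xy(2)] xy(3) q]
      halo_colour[OF subsetD[OF sub(1) xy(1)] subsetD[OF sub(1) xy(2)] xy(3) q] by simp
qed

text \<open>A single pair \<open>x\<close>, \<open>y\<close> near \<open>m\<close> controls only its own halo, a 2-sphere close to the 3-sphere of radius \<open>a\<close> around \<open>m\<close>,
  and that halo may be far from \<open>q0\<close>. But a third point \<open>p\<close>, displaced from \<open>m\<close> perpendicularly to \<open>q0 - m\<close> by
  much more than \<open>x\<close> and \<open>y\<close> are, differs in colour from one of the two, and the halo of that pair
  passes close to \<open>q0\<close>.\<close>
lemma halo_colour_dense:
  assumes m: "m \<in> interface" and q0: "dist q0 m = a"
  shows "q0 \<in> closure {q. col q = halo_colour m}"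
  unfolding closure_approachable
proof (intro allI impI)
  fix r :: real assume "0 < r"
  define M where "M = 1 + 2 * a + 1 / a"
  have "0 < M"
    using a_pos by (simp add: M_def add_pos_pos)
  define t where "t = Min {1 / 2, a, h / 4, r / (2 * M)}"
  have t: "0 < t" "t < 1" "t \<le> a" "t \<le> h / 4" "t \<le> r / (2 * M)"
  proof -
    show "0 < t"
      using \<open>0 < r\<close> \<open>0 < M\<close> a_pos h(1) by (simp add: t_def)
    have "t \<le> 1 / 2"
      by (simp add: t_def)
    then show "t < 1"
      by simp
  qed (simp_all add: t_def)
  have tt: "t\<^sup>2 \<le> t"
    using t by (simp add: power2_eq_square)
  obtain x y where xy: "x \<in> ball m (t\<^sup>2)" "y \<in> ball m (t\<^sup>2)" "col x \<noteq> col y"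
    by (rule interfaceE[OF m, of "t\<^sup>2"]) (use t(1) in auto)
  obtain u where u: "norm u = 1" "u \<bullet> (q0 - m) = 0" "u \<bullet> (x - m) = 0" "u \<bullet> (y - m) = 0"
    using unit_vector_orthogonal_to_three[OF dim] by metis
  define p where "p = m + t *\<^sub>R u"
  obtain z where z: "z \<in> ball m (t\<^sup>2)" "u \<bullet> (z - m) = 0" "col p \<noteq> col z"
    using xy u by metis
  have zm: "dist z m \<le> t\<^sup>2"
    using z(1) by (simp add: dist_commute)
  obtain q where q: "q \<in> equidistant a z p" "dist q q0 \<le> t * M"
    using equidistant_point_near[OF q0 u(1,2) z(2) t(1,2,3) zm p_def] unfolding M_def .
  have "p \<in> ball m (h / 2)"
    using t u(1) h(1) by (simp add: p_def dist_norm)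
  moreover have "z \<in> ball m (h / 2)"
    using z(1) t(4) tt h(1) by simp
  ultimately have "col q = halo_colour m"
    using halo_colour[of p m z q] z(3) q(1) by (simp add: equidistant_commute)
  moreover have "t * M < r"
  proof -
    have "t * M \<le> r / (2 * M) * M"
      using t(5) \<open>0 < M\<close> by (intro mult_right_mono) auto
    also have "\<dots> < r"
      using \<open>0 < M\<close> \<open>0 < r\<close> by simp
    finally show ?thesis .
  qed
  ultimately show "\<exists>q\<in>{q. col q = halo_colour m}. dist q q0 < r"
    using q(2) by auto
qed

lemma interface_if_two_closures:
  assumes "m \<in> closure {q. col q = k}" "m \<in> closure {q. col q = l}" "k \<noteq> l"
  shows "m \<in> interface"
  unfolding interface_def
proof (intro CollectI allI impI)
  fix r :: real assume "0 < r"
  obtain x where "col x = k" "dist x m < r"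
    using assms(1) \<open>0 < r\<close> unfolding closure_approachable by auto
  moreover obtain y where "col y = l" "dist y m < r"
    using assms(2) \<open>0 < r\<close> unfolding closure_approachable by auto
  ultimately show "\<exists>x\<in>ball m r. \<exists>y\<in>ball m r. col x \<noteq> col y"
    using assms(3) by (intro bexI[of _ x] bexI[of _ y]) (auto simp: dist_commute)
qed

lemma halo_colour_not_in_closure:
  assumes "m \<in> interface"
  shows "m \<notin> closure {q. col q = halo_colour m}"
proof
  assume "m \<in> closure {q. col q = halo_colour m}"
  then obtain p where "col p = halo_colour m" "dist p m < h / 2"
    unfolding closure_approachable using h(1) half_gt_zero by blast
  then show False
    using halo_colour_not_near[OF assms, of p] by (simp add: dist_commute)
qed

text \<open>The contradiction comes from two points at distance \<open>a\<close> that have the same halo colour: each is a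
  limit of points of the halo colour of the other, hence of its own. Such points lie on the
  intersection of two spheres of radius \<open>a\<close> around interface points with different halo colours.\<close>
lemma interface_empty: "interface = {}"
proof (rule ccontr)
  assume "interface \<noteq> {}"
  then obtain m where m: "m \<in> interface"
    by blast
  define X where "X = closure {q. col q = halo_colour m}"
  have mX: "m \<notin> X"
    using halo_colour_not_in_closure[OF m] by (simp add: X_def)
  have sphere: "q \<in> X" if "dist q m = a" for q
    using halo_colour_dense[OF m that] by (simp add: X_def)
  obtain s where s: "s \<in> equidistant a m m"
    using equidistant_nonempty[OF dim, of a m m] a_pos by auto
  then have "s \<in> X"
    by (intro sphere) (simp add: equidistant_def)
  then obtain n where n: "n \<in> X" "\<And>y. y \<in> X \<Longrightarrow> dist m n \<le> dist m y"
    using distance_attains_inf[of X m] by (metis X_def closed_closure empty_iff)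
  have mn: "0 < dist m n" "dist m n \<le> a"
    using n(1) mX n(2)[OF \<open>s \<in> X\<close>] s by (auto simp: equidistant_def dist_commute)
  \<comment> \<open>Points slightly closer to \<open>m\<close> than \<open>n\<close> lie outside \<open>X\<close>.\<close>
  have near_n: "\<exists>p. col p \<noteq> halo_colour m \<and> dist p n < r" if "0 < r" for r
  proof -
    define t where "t = min (1 / 2) (r / (2 * dist m n))"
    have t: "0 < t" "t \<le> 1 / 2" "t * dist m n < r"
    proof -
      show "0 < t"
        using that mn by (simp add: t_def)
      have "t * dist m n \<le> r / (2 * dist m n) * dist m n"
        by (intro mult_right_mono) (simp_all add: t_def)
      also have "\<dots> < r"
        using that mn by simp
      finally show "t * dist m n < r" .
    qed (simp add: t_def)
    define p where "p = n + t *\<^sub>R (m - n)"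
    have pn: "dist p n = t * dist m n"
      using t(1) by (simp add: p_def dist_norm)
    have "m - p = (1 - t) *\<^sub>R (m - n)"
      by (simp add: p_def algebra_simps)
    then have "dist m p = (1 - t) * dist m n"
      using t by (simp add: dist_norm)
    also have "\<dots> < dist m n"
      using t mn by simp
    finally have "p \<notin> X"
      using n(2)[of p] by linarith
    then have "col p \<noteq> halo_colour m"
      using closure_subset[of "{q. col q = halo_colour m}"] by (auto simp: X_def)
    then show ?thesis
      using pn t(3) by auto
  qed
  have n_interface: "n \<in> interface"
    unfolding interface_def
  proof (intro CollectI allI impI)
    fix r :: real assume r: "0 < r"
    obtain x where "col x = halo_colour m" "dist x n < r"
      using n(1) r unfolding X_def closure_approachable by auto
    moreover obtain y where "col y \<noteq> halo_colour m" "dist y n < r"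
      using near_n[OF r] by auto
    ultimately show "\<exists>x\<in>ball n r. \<exists>y\<in>ball n r. col x \<noteq> col y"
      by (intro bexI[of _ x] bexI[of _ y]) (auto simp: dist_commute)
  qed
  have ne: "halo_colour m \<noteq> halo_colour n"
    using halo_colour_not_in_closure[OF n_interface] n(1) by (auto simp: X_def)
  define S where "S = equidistant a m n"
  have S_interface: "g \<in> interface" if "g \<in> S" for g
    using that halo_colour_dense[OF m, of g] halo_colour_dense[OF n_interface, of g] ne
    by (intro interface_if_two_closures) (auto simp: S_def equidistant_def)
  have "halo_colour constant_on S"
  proof (rule locally_constant_imp_constant)
    show "connected S"
      unfolding S_def using mn a_pos by (intro connected_equidistant dim) auto
    fix g assume g: "g \<in> S"
    let ?U = "S \<inter> ball g (h / 2)"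
    have "halo_colour g' = halo_colour g" if "g' \<in> ?U" for g'
      using that g by (intro halo_colour_eq_of_close S_interface) (auto simp: dist_commute)
    moreover have "openin (top_of_set S) ?U" "g \<in> ?U"
      using g h(1) by (simp_all add: openin_open_Int)
    ultimately show "\<exists>U. openin (top_of_set S) U \<and> g \<in> U \<and> (\<forall>g'\<in>U. halo_colour g' = halo_colour g)"
      by blast
  qed
  then have const: "halo_colour g = halo_colour g'" if "g \<in> S" "g' \<in> S" for g g'
    using that unfolding constant_on_def by metis
  \<comment> \<open>The 2-sphere \<open>S\<close> has radius \<open>R\<close>. As \<open>dist m n \<le> a\<close>, its diameter exceeds \<open>a\<close>, so it has a chord
    of length \<open>a\<close>: with this inner product the vectors \<open>v\<close> and \<open>v'\<close> differ by a vector of length \<open>a\<close>.\<close>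
  define R where "R = sqrt (a\<^sup>2 - (dist m n)\<^sup>2 / 4)"
  have "(dist m n)\<^sup>2 \<le> a\<^sup>2"
    using mn by (intro power_mono) auto
  then have "0 \<le> a\<^sup>2 - (dist m n)\<^sup>2 / 4"
    using zero_le_power2[of a] by linarith
  then have R: "R\<^sup>2 = a\<^sup>2 - (dist m n)\<^sup>2 / 4" "0 \<le> R"
    by (simp_all add: R_def)
  obtain u where u: "norm u = 1" "u \<bullet> (m - n) = 0"
    using unit_vector_orthogonal_to_three[OF dim] by metis
  define v where "v = R *\<^sub>R u"
  have v: "v \<bullet> (m - n) = 0" "norm v = R"
    using u R(2) by (simp_all add: v_def)
  have "R\<^sup>2 * R\<^sup>2 - (R\<^sup>2 - a\<^sup>2 / 2)\<^sup>2 = a\<^sup>2 * (R\<^sup>2 - a\<^sup>2 / 4)"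
    by (simp add: power2_diff power2_eq_square[of "R\<^sup>2"] power2_eq_square[of "a\<^sup>2"] right_diff_distrib power_divide)
  also have "0 \<le> \<dots>"
    using R(1) \<open>(dist m n)\<^sup>2 \<le> a\<^sup>2\<close> zero_le_power2[of a] by (intro mult_nonneg_nonneg) linarith+
  finally have "(R\<^sup>2 - a\<^sup>2 / 2)\<^sup>2 \<le> R\<^sup>2 * (norm v)\<^sup>2"
    by (simp add: v(2))
  then obtain v' where v': "v' \<bullet> (m - n) = 0" "v' \<bullet> v = R\<^sup>2 - a\<^sup>2 / 2" "norm v' = R"
    using vector_with_prescribed_inner[OF dim v(1) v(1) R(2)] by metis
  have "v' \<bullet> v' = R\<^sup>2" "v \<bullet> v = R\<^sup>2"
    using v v' by (simp_all flip: power2_norm_eq_inner)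
  then have "dist v' v = a"
    using v'(2) a_pos by (simp add: dist_eq_iff inner_diff_left inner_diff_right inner_commute[of v v'])
  moreover have S: "midpoint m n + v \<in> S" "midpoint m n + v' \<in> S"
    using v v' R(1) a_pos by (simp_all add: S_def mem_equidistant_iff)
  ultimately have "midpoint m n + v' \<in> closure {q. col q = halo_colour (midpoint m n + v)}"
    by (intro halo_colour_dense S_interface) simp_all
  then show False
    using halo_colour_not_in_closure[OF S_interface[OF S(2)]] const[OF S] by simp
qed

lemma col_constant: "col x = col y"
proof -
  have "col constant_on UNIV"
  proof (rule locally_constant_imp_constant)
    show "connected (UNIV :: 'a set)"
      by (rule connected_UNIV)
    fix m :: 'a
    have "m \<notin> interface"
      by (simp add: interface_empty)
    then obtain r where r: "0 < r" "\<And>y z. y \<in> ball m r \<Longrightarrow> z \<in> ball m r \<Longrightarrow> col y = col z"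
      unfolding interface_def by blast
    have "\<forall>y\<in>ball m r. col y = col m"
      by (intro ballI r(2)) (use r(1) in simp_all)
    moreover have "openin (top_of_set UNIV) (ball m r)" "m \<in> ball m r"
      using r(1) by simp_all
    ultimately show "\<exists>U. openin (top_of_set UNIV) U \<and> m \<in> U \<and> (\<forall>y\<in>U. col y = col m)"
      by blast
  qed
  then show ?thesis
    unfolding constant_on_def by (metis UNIV_I)
qed

end

section \<open>Triangles\<close>

lemma triangle_copy_exists:
  fixes a b c :: real
  assumes dim: "4 \<le> DIM('a::euclidean_space)"
    and pos: "0 < a" "0 < b" "0 < c" and tri: "a < b + c" "b < a + c" "c < a + b"
  obtains p q z :: "'a::euclidean_space" where "dist p q = a" "dist p z = b" "dist q z = c"
proof -
  obtain e where e: "0 < e"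
    "\<And>x y q q' :: 'a. dist x y \<le> e \<Longrightarrow> dist q q' \<le> e \<Longrightarrow> q \<in> equidistant a x y \<Longrightarrow>
       q' \<in> equidistant a x y \<Longrightarrow> \<exists>z \<in> equidistant b x y. dist z q = c \<and> dist z q' = c"
    by (rule common_neighbour[OF dim pos tri]) auto
  obtain q where q: "q \<in> equidistant a (0::'a) 0"
    using equidistant_nonempty[OF dim, of a 0 0] pos by auto
  obtain z where z: "z \<in> equidistant b (0::'a) 0" "dist z q = c"
    using e(2)[of 0 0 q q] q e(1) by auto
  show thesis
    by (rule that[of 0 q z]) (use q z in \<open>simp_all add: equidistant_def dist_commute\<close>)
qed

lemma triangle_not_two_coloured:
  fixes col :: "'a::euclidean_space \<Rightarrow> 'k" and a b c :: real
  assumes dim: "4 \<le> DIM('a)"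
    and pos: "0 < a" "0 < b" "0 < c" and tri: "a < b + c" "b < a + c" "c < a + b"
  obtains p q z where "dist p q = a" "dist p z = b" "dist q z = c" "\<not> two_coloured col p q z"
proof -
  have "\<exists>p q z. dist p q = a \<and> dist p z = b \<and> dist q z = c \<and> \<not> two_coloured col p q z"
  proof (rule ccontr)
    assume "\<not> ?thesis"
    then have two: "\<And>p q z. dist p q = a \<Longrightarrow> dist p z = b \<Longrightarrow> dist q z = c \<Longrightarrow> two_coloured col p q z"
      by blast
    obtain e where "monochromatic_haloes col a e"
      using halo_monochromatic[OF dim pos tri two] by blast
    then interpret monochromatic_haloes col a e .
    obtain p q z :: 'a where "dist p q = a" "dist p z = b" "dist q z = c"
      using triangle_copy_exists[OF dim pos tri] .
    then have "two_coloured col p q z"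
      by (rule two)
    then show False
      using col_constant[of p q] col_constant[of q z] by (simp add: two_coloured_def)
  qed
  then show thesis
    using that by blast
qed

lemma triangle_vertices:
  fixes T :: "'b::euclidean_space set"
  assumes "is_triangle T"
  obtains A B C where "T = {A, B, C}" "A \<noteq> B" "A \<noteq> C" "B \<noteq> C"
    "dist A B < dist A C + dist B C" "dist A C < dist A B + dist B C" "dist B C < dist A B + dist A C"
proof -
  obtain A B C where T: "T = {A, B, C}" "A \<noteq> B" "A \<noteq> C" "B \<noteq> C"
    using assms unfolding is_triangle_def card_3_iff by metis
  have nc: "\<not> collinear {A, B, C}"
    using assms T(1) by (simp add: is_triangle_def)
  have strict: "dist x y < dist x z + dist z y" if "{x, y, z} = {A, B, C}" for x y z
  proof -
    have "\<not> collinear {x, y, z}"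
      using nc that by simp
    then have "\<not> between (x, y) z"
      unfolding collinear_between_cases by (simp add: between_commute)
    then show ?thesis
      using dist_triangle[of x y z] by (simp add: between)
  qed
  have "dist A B < dist A C + dist C B" "dist A C < dist A B + dist B C" "dist B C < dist B A + dist A C"
    by (rule strict; blast)+
  then show thesis
    by (intro that[OF T]) (simp_all add: dist_commute)
qed

theorem theorem1p2:
  fixes T :: "'b::euclidean_space set" and r :: nat
  assumes "is_triangle T" and "r \<ge> 1"
  shows "gallai_ramsey TYPE(real ^ 4) r T T"
  unfolding gallai_ramsey_def
proof (intro allI impI)
  fix col :: "real ^ 4 \<Rightarrow> nat"
  obtain A B C where T: "T = {A, B, C}" and ne: "A \<noteq> B" "A \<noteq> C" "B \<noteq> C"
    and tri: "dist A B < dist A C + dist B C" "dist A C < dist A B + dist B C" "dist B C < dist A B + dist A C"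
    using triangle_vertices[OF assms(1)] .
  have dim: "4 \<le> DIM(real ^ 4)"
    by simp
  have pos: "0 < dist A B" "0 < dist A C" "0 < dist B C"
    using ne by simp_all
  obtain p q z :: "real ^ 4" where pqz: "dist p q = dist A B" "dist p z = dist A C" "dist q z = dist B C"
    and nt: "\<not> two_coloured col p q z"
    using triangle_not_two_coloured[OF dim pos tri] .
  define f where "f X = (if X = A then p else if X = B then q else z)" for X
  have f: "f A = p" "f B = q" "f C = z"
    using ne by (simp_all add: f_def)
  have "\<forall>X\<in>T. \<forall>Y\<in>T. dist (f X) (f Y) = dist X Y"
    using pqz unfolding T by (simp add: f dist_commute)
  moreover have "f ` T = {p, q, z}"
    by (simp add: T f)
  ultimately have "congruent_copy T {p, q, z}"
    unfolding congruent_copy_def by (intro exI[of _ f]) simp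
  moreover have "monochromatic col {p, q, z} \<or> rainbow col {p, q, z}"
  proof (cases "col p = col q \<and> col q = col z")
    case True
    then show ?thesis
      by (simp add: monochromatic_def)
  next
    case False
    with nt have "col p \<noteq> col q" "col q \<noteq> col z" "col p \<noteq> col z"
      by (simp_all add: two_coloured_def)
    then show ?thesis
      by (auto simp: rainbow_def inj_on_def)
  qed
  ultimately show "(\<exists>C. congruent_copy T C \<and> monochromatic col C) \<or>
    (\<exists>C. congruent_copy T C \<and> rainbow col C)"
    by blast
qed

end
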